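(* Let $(X,d)$ and $(Y,\rho)$ be compact metric spaces, and let $f_{1,\infty}=\{f_i\}_{i=1}^\infty$ and $g_{1,\infty}=\{g_i\}_{i=1}^\infty$ be sequences of continuous self-maps on $X$ and $Y$, respectively. Suppose $\pi_{1,\infty}=\{\pi_i\}_{i=1}^\infty$ is a topological equisemiconjugacy from $(X,f_{1,\infty})$ to $(Y,g_{1,\infty})$. Then for every $Z\subseteq X$, $k\in\mathbb N$ and $\theta\in[0,1]$, \[ \underline{h}_{\mathrm{top}}(f_{k,\infty},Z,\theta)\ge\underline{h}_{\mathrm{top}}(g_{k,\infty},\pi_k(Z),\theta),\qquad \overline{h}_{\mathrm{top}}(f_{k,\infty},Z,\theta)\ge\overline{h}_{\mathrm{top}}(g_{k,\infty},\pi_k(Z),\theta). \] If $\pi_{1,\infty}$ is a topological equiconjugacy, then equality holds: \[ \underline{h}_{\mathrm{top}}(f_{k,\infty},Z,\theta)=\underline{h}_{\mathrm{top}}(g_{k,\infty},\pi_k(Z),\theta),\qquad \overline{h}_{\mathrm{top}}(f_{k,\infty},Z,\theta)=\overline{h}_{\mathrm{top}}(g_{k,\infty},\pi_k(Z),\theta). \]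
   Context: Intermediate topological entropies. Let $X$ be a compact topological space and $f_{1,\infty}=\{f_i\}_{i=1}^\infty$ a sequence of continuous maps $X\to X$. Put $f_i^0=\mathrm{id}_X$ and $f_i^j=f_{i+j-1}\circ\cdots\circ f_{i+1}\circ f_i$ for $j\ge1$. For a finite open cover $\mathcal U$ of $X$ and $m\in\mathbb N=\{1,2,\dots\}$, a string of length $m(\mathbf U)=m$ is an element $\mathbf U=(U_0,\dots,U_{m-1})\in\mathcal S_m(\mathcal U):=\mathcal U^m$, and $X(\mathbf U)=\{x\in X: f_1^j(x)\in U_j,\ 0\le j\le m-1\}$. For $Z\subseteq X$, $\alpha\ge0$, $\theta\in[0,1]$, $N\in\mathbb N$ let \[ M(Z,\alpha,\mathcal U,N,\theta)=\inf_{\mathcal G}\sum_{\mathbf U\in\mathcal G}e^{-\alpha m(\mathbf U)}, \] the infimum over all finite or countable collections $\mathcal G\subseteq\bigcup_{N\le m<N/\theta+1}\mathcal S_m(\mathcal U)$ with $Z\subseteq\bigcup_{\mathbf U\in\mathcal G}X(\mathbf U)$ (for $\theta=0$, $N/\theta=+\infty$). Let $\underline m(Z,\alpha,\mathcal U,\theta)=\liminf_{N\to\infty}M(Z,\alpha,\mathcal U,N,\theta)$ and $\overline m(Z,\alpha,\mathcal U,\theta)=\limsup_{N\to\infty}M(Z,\alpha,\mathcal U,N,\theta)$. Set $\underline h_{\mathrm{top}}(f_{1,\infty},Z,\mathcal U,\theta)=\inf\{\alpha\ge0:\underline m(Z,\alpha,\mathcal U,\theta)=0\}$, $\overline h_{\mathrm{top}}(f_{1,\infty},Z,\mathcal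 U,\theta)=\inf\{\alpha\ge0:\overline m(Z,\alpha,\mathcal U,\theta)=0\}$. The lower and upper $\theta$-intermediate topological entropies $\underline h_{\mathrm{top}}(f_{1,\infty},Z,\theta)$ and $\overline h_{\mathrm{top}}(f_{1,\infty},Z,\theta)$, with values in $[0,\infty]$, are the suprema of these quantities over all finite open covers $\mathcal U$ of $X$. For $k\in\mathbb N$, $f_{k,\infty}=\{f_k,f_{k+1},\dots\}$ denotes the shifted sequence, and its entropies are defined in the same way (with $f_k^j$ in place of $f_1^j$). Conjugacy notions. A semiconjugacy from $(X,f_{1,\infty})$ to $(Y,g_{1,\infty})$ is a sequence $\pi_{1,\infty}=\{\pi_i\}_{i=1}^\infty$ of surjective continuous maps $\pi_i:X\to Y$ with $\pi_{i+1}\circ f_i=g_i\circ\pi_i$ for all $i\ge1$. It is a topological equisemiconjugacy if moreover $\{\pi_i\}$ is equicontinuous (for each $\varepsilon>0$ there is $\delta>0$ with $d(x,y)<\delta\Rightarrow\rho(\pi_i(x),\pi_i(y))<\varepsilon$ for all $i$). It is a topological equiconjugacy if in addition each $\pi_i$ is a homeomorphism and $\{\pi_i^{-1}\}_{i=1}^\infty$ is also equicontinuous. *)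

theory Defs
  imports "HOL-Analysis.Analysis"
begin

text \<open>
  A sequence \<open>f\<^sub>1, f\<^sub>2, \<dots>\<close> is a function on \<^typ>\<open>nat\<close> of which only the values at
  indices \<open>i \<ge> 1\<close> are used; the value at \<open>0\<close> is irrelevant.
\<close>

text \<open>\<open>seq_iter f i j\<close> is \<open>f\<^sub>i\<^sup>j = f\<^bsub>i+j-1\<^esub> \<circ> \<dots> \<circ> f\<^sub>i\<close>.\<close>

primrec seq_iter :: "(nat \<Rightarrow> 'a \<Rightarrow> 'a) \<Rightarrow> nat \<Rightarrow> nat \<Rightarrow> 'a \<Rightarrow> 'a" where
  "seq_iter f i 0 = id"
| "seq_iter f i (Suc j) = f (i + j) \<circ> seq_iter f i j"

text \<open>The shifted sequence \<open>f\<^sub>k, f\<^bsub>k+1\<^esub>, \<dots>\<close> (for \<open>k \<ge> 1\<close>), again indexed from \<open>1\<close>.\<close>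

definition shift_seq :: "nat \<Rightarrow> (nat \<Rightarrow> 'c) \<Rightarrow> nat \<Rightarrow> 'c" where
  "shift_seq k f = (\<lambda>i. f (k + i - 1))"

lemma seq_iter_shift_seq: "seq_iter (shift_seq k f) 1 j = seq_iter f k j"
  by (induction j) (simp_all add: shift_seq_def)

definition finite_open_cover :: "'a topology \<Rightarrow> 'a set set \<Rightarrow> bool" where
  "finite_open_cover X \<U> \<longleftrightarrow>
     finite \<U> \<and> (\<forall>U\<in>\<U>. openin X U) \<and> \<Union>\<U> = topspace X"

definition strings :: "'a set set \<Rightarrow> nat \<Rightarrow> 'a set list set" where
  "strings \<U> m = {us. length us = m \<and> set us \<subseteq> \<U>}"

definition string_set :: "'a topology \<Rightarrow> (nat \<Rightarrow> 'a \<Rightarrow> 'a) \<Rightarrow> 'a set list \<Rightarrow> 'a set" where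
  "string_set X f us = {x \<in> topspace X. \<forall>j<length us. seq_iter f 1 j x \<in> us ! j}"

text \<open>
  Lengths \<open>m\<close> with \<open>N \<le> m < N/\<theta> + 1\<close>.  The case \<open>\<theta> = 0\<close>, where \<open>N/\<theta> = \<infinity>\<close>, is separate
  because division by zero yields \<open>0\<close> in HOL.
\<close>

definition admissible_lengths :: "nat \<Rightarrow> real \<Rightarrow> nat set" where
  "admissible_lengths N \<theta> = {m. N \<le> m \<and> (\<theta> = 0 \<or> real m < real N / \<theta> + 1)}"

definition admissible_covers ::
  "'a topology \<Rightarrow> (nat \<Rightarrow> 'a \<Rightarrow> 'a) \<Rightarrow> 'a set \<Rightarrow> 'a set set \<Rightarrow> nat \<Rightarrow> real \<Rightarrow> 'a set list set set"
where
  "admissible_covers X f Z \<U> N \<theta> =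
     {G. countable G \<and> G \<subseteq> (\<Union>m\<in>admissible_lengths N \<theta>. strings \<U> m) \<and>
         Z \<subseteq> (\<Union>us\<in>G. string_set X f us)}"

definition string_M ::
  "'a topology \<Rightarrow> (nat \<Rightarrow> 'a \<Rightarrow> 'a) \<Rightarrow> 'a set \<Rightarrow> real \<Rightarrow> 'a set set \<Rightarrow> nat \<Rightarrow> real \<Rightarrow> ennreal"
where
  "string_M X f Z \<alpha> \<U> N \<theta> =
     (INF G\<in>admissible_covers X f Z \<U> N \<theta>.
        \<Sum>\<^sub>\<infinity>us\<in>G. ennreal (exp (- \<alpha> * real (length us))))"

definition lower_m ::
  "'a topology \<Rightarrow> (nat \<Rightarrow> 'a \<Rightarrow> 'a) \<Rightarrow> 'a set \<Rightarrow> real \<Rightarrow> 'a set set \<Rightarrow> real \<Rightarrow> ennreal"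
where
  "lower_m X f Z \<alpha> \<U> \<theta> = liminf (\<lambda>N. string_M X f Z \<alpha> \<U> N \<theta>)"

definition upper_m ::
  "'a topology \<Rightarrow> (nat \<Rightarrow> 'a \<Rightarrow> 'a) \<Rightarrow> 'a set \<Rightarrow> real \<Rightarrow> 'a set set \<Rightarrow> real \<Rightarrow> ennreal"
where
  "upper_m X f Z \<alpha> \<U> \<theta> = limsup (\<lambda>N. string_M X f Z \<alpha> \<U> N \<theta>)"

text \<open>The infimum over an empty set of exponents is \<open>\<infinity>\<close>.\<close>

definition lower_entropy_cover ::
  "'a topology \<Rightarrow> (nat \<Rightarrow> 'a \<Rightarrow> 'a) \<Rightarrow> 'a set \<Rightarrow> 'a set set \<Rightarrow> real \<Rightarrow> ennreal"
where
  "lower_entropy_cover X f Z \<U> \<theta> =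
     (INF \<alpha>\<in>{\<alpha>. 0 \<le> \<alpha> \<and> lower_m X f Z \<alpha> \<U> \<theta> = 0}. ennreal \<alpha>)"

definition upper_entropy_cover ::
  "'a topology \<Rightarrow> (nat \<Rightarrow> 'a \<Rightarrow> 'a) \<Rightarrow> 'a set \<Rightarrow> 'a set set \<Rightarrow> real \<Rightarrow> ennreal"
where
  "upper_entropy_cover X f Z \<U> \<theta> =
     (INF \<alpha>\<in>{\<alpha>. 0 \<le> \<alpha> \<and> upper_m X f Z \<alpha> \<U> \<theta> = 0}. ennreal \<alpha>)"

definition lower_entropy ::
  "'a topology \<Rightarrow> (nat \<Rightarrow> 'a \<Rightarrow> 'a) \<Rightarrow> 'a set \<Rightarrow> real \<Rightarrow> ennreal"
where
  "lower_entropy X f Z \<theta> = (SUP \<U>\<in>{\<U>. finite_open_cover X \<U>}. lower_entropy_cover X f Z \<U> \<theta>)"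

definition upper_entropy ::
  "'a topology \<Rightarrow> (nat \<Rightarrow> 'a \<Rightarrow> 'a) \<Rightarrow> 'a set \<Rightarrow> real \<Rightarrow> ennreal"
where
  "upper_entropy X f Z \<theta> = (SUP \<U>\<in>{\<U>. finite_open_cover X \<U>}. upper_entropy_cover X f Z \<U> \<theta>)"

definition semiconjugacy ::
  "'a topology \<Rightarrow> (nat \<Rightarrow> 'a \<Rightarrow> 'a) \<Rightarrow> 'b topology \<Rightarrow> (nat \<Rightarrow> 'b \<Rightarrow> 'b) \<Rightarrow> (nat \<Rightarrow> 'a \<Rightarrow> 'b) \<Rightarrow> bool"
where
  "semiconjugacy X f Y g \<pi> \<longleftrightarrow>
     (\<forall>i\<ge>1. continuous_map X Y (\<pi> i) \<and> \<pi> i ` topspace X = topspace Y \<and>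
        (\<forall>x\<in>topspace X. \<pi> (Suc i) (f i x) = g i (\<pi> i x)))"

definition equicontinuous_seq ::
  "'a set \<Rightarrow> ('a \<Rightarrow> 'a \<Rightarrow> real) \<Rightarrow> ('b \<Rightarrow> 'b \<Rightarrow> real) \<Rightarrow> (nat \<Rightarrow> 'a \<Rightarrow> 'b) \<Rightarrow> bool"
where
  "equicontinuous_seq X d \<rho> \<pi> \<longleftrightarrow>
     (\<forall>\<epsilon>>0. \<exists>\<delta>>0. \<forall>i\<ge>1. \<forall>x\<in>X. \<forall>y\<in>X. d x y < \<delta> \<longrightarrow> \<rho> (\<pi> i x) (\<pi> i y) < \<epsilon>)"

definition equisemiconjugacy ::
  "'a set \<Rightarrow> ('a \<Rightarrow> 'a \<Rightarrow> real) \<Rightarrow> (nat \<Rightarrow> 'a \<Rightarrow> 'a) \<Rightarrow>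
   'b set \<Rightarrow> ('b \<Rightarrow> 'b \<Rightarrow> real) \<Rightarrow> (nat \<Rightarrow> 'b \<Rightarrow> 'b) \<Rightarrow> (nat \<Rightarrow> 'a \<Rightarrow> 'b) \<Rightarrow> bool"
where
  "equisemiconjugacy X d f Y \<rho> g \<pi> \<longleftrightarrow>
     semiconjugacy (Metric_space.mtopology X d) f (Metric_space.mtopology Y \<rho>) g \<pi> \<and>
     equicontinuous_seq X d \<rho> \<pi>"

definition equiconjugacy ::
  "'a set \<Rightarrow> ('a \<Rightarrow> 'a \<Rightarrow> real) \<Rightarrow> (nat \<Rightarrow> 'a \<Rightarrow> 'a) \<Rightarrow>
   'b set \<Rightarrow> ('b \<Rightarrow> 'b \<Rightarrow> real) \<Rightarrow> (nat \<Rightarrow> 'b \<Rightarrow> 'b) \<Rightarrow> (nat \<Rightarrow> 'a \<Rightarrow> 'b) \<Rightarrow> bool"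
where
  "equiconjugacy X d f Y \<rho> g \<pi> \<longleftrightarrow>
     equisemiconjugacy X d f Y \<rho> g \<pi> \<and>
     (\<forall>i\<ge>1. homeomorphic_map (Metric_space.mtopology X d) (Metric_space.mtopology Y \<rho>) (\<pi> i)) \<and>
     equicontinuous_seq Y \<rho> d (\<lambda>i. inv_into X (\<pi> i))"

end

theory Submission
  imports Defs
begin

text \<open>
  Given a finite open cover \<open>\<V>\<close> of \<open>Y\<close> with Lebesgue number \<open>\<epsilon>\<close>, equicontinuity yields one
  \<open>\<delta>\<close> such that every \<open>\<pi>\<^sub>i\<close> maps each \<open>\<delta>\<close>-ball of \<open>X\<close> into some member of \<open>\<V>\<close>.  By compactness
  finitely many \<open>\<delta>\<close>-balls form a cover \<open>\<U>\<close> of \<open>X\<close>, and choosing such a member for every ball and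
  every time turns strings over \<open>\<U>\<close> into strings over \<open>\<V>\<close> of the same length.  Covers of \<open>Z\<close> thus
  become covers of \<open>\<pi>\<^sub>1(Z)\<close> of no larger weight.  Equality for an equiconjugacy follows by applying
  the inequality to the inverse sequence.
\<close>

section \<open>Orbits and strings under a semiconjugacy\<close>

lemma seq_iter_in_topspace:
  assumes "\<And>i. i \<ge> 1 \<Longrightarrow> continuous_map X X (f i)" "x \<in> topspace X"
  shows "seq_iter f 1 j x \<in> topspace X"
proof (induction j)
  case (Suc j)
  then show ?case
    using continuous_map_image_subset_topspace[OF assms(1)[of "1 + j"]] by auto
qed (use assms in auto)

text \<open>The commuting squares of the single steps are pasted together. Orbits start at index 1,
  so after \<open>j\<close> steps the vertical map is \<open>\<pi> (Suc j)\<close>. Each square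
  commutes on the space only, hence the orbit must stay there.\<close>

lemma semiconjugacy_seq_iter:
  assumes f: "\<And>i. i \<ge> 1 \<Longrightarrow> continuous_map X X (f i)"
    and "semiconjugacy X f Y g \<pi>" and x: "x \<in> topspace X"
  shows "\<pi> (Suc j) (seq_iter f 1 j x) = seq_iter g 1 j (\<pi> 1 x)"
proof (induction j)
  case (Suc j)
  then show ?case
    using assms(2) seq_iter_in_topspace[OF f x] by (simp add: semiconjugacy_def)
qed simp

text \<open>\<open>F\<close> may identify elements of \<open>A\<close>. One preimage per point of
  the image turns the left side into a sum over a subset of \<open>A\<close>, and enlarging the
  index set cannot decrease a sum of \<open>ennreal\<close> terms.\<close>

lemma infsum_image_le_ennreal:
  fixes w :: "'a \<Rightarrow> ennreal"
  assumes "\<And>x. x \<in> A \<Longrightarrow> w' (F x) = w x"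
  shows "(\<Sum>\<^sub>\<infinity>y\<in>F ` A. w' y) \<le> (\<Sum>\<^sub>\<infinity>x\<in>A. w x)"
proof -
  define h where "h = inv_into A F"
  have inj: "inj_on h (F ` A)"
    unfolding h_def by (rule inj_on_inv_into) simp
  have sub: "h ` (F ` A) \<subseteq> A"
    unfolding h_def by (auto intro: inv_into_into)
  have "(\<Sum>\<^sub>\<infinity>y\<in>F ` A. w' y) = (\<Sum>\<^sub>\<infinity>y\<in>F ` A. (w \<circ> h) y)"
  proof (rule infsum_cong)
    fix y assume y: "y \<in> F ` A"
    then have "h y \<in> A" "F (h y) = y"
      unfolding h_def by (auto intro: inv_into_into f_inv_into_f)
    then show "w' y = (w \<circ> h) y"
      using assms[of "h y"] by simp
  qed
  also have "\<dots> = infsum w (h ` (F ` A))"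
    using infsum_reindex[OF inj] by metis
  also have "\<dots> \<le> infsum w A"
    using sub by (intro infsum_mono_neutral) (auto intro: nonneg_summable_on_complete)
  finally show ?thesis .
qed

text \<open>Strings are translated letter by letter. Position \<open>j\<close> constrains the point
  reached after \<open>j\<close> steps, so its letter is translated through
  \<open>\<pi> (Suc j)\<close>, and \<open>\<phi>\<close> may depend on \<open>j\<close>. Lengths do
  not change, so neither do admissibility and weights; the comparison therefore holds at each
  \<open>N\<close>, before any limit is taken.\<close>

lemma string_M_le_semiconjugacy:
  assumes f: "\<And>i. i \<ge> 1 \<Longrightarrow> continuous_map X X (f i)"
    and \<pi>: "semiconjugacy X f Y g \<pi>" and Z: "Z \<subseteq> topspace X"
    and \<phi>: "\<And>j U. U \<in> \<U> \<Longrightarrow> \<phi> j U \<in> \<V> \<and> \<pi> (Suc j) ` U \<subseteq> \<phi> j U"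
  shows "string_M Y g (\<pi> 1 ` Z) \<alpha> \<V> N \<theta> \<le> string_M X f Z \<alpha> \<U> N \<theta>"
  unfolding string_M_def
proof (rule INF_mono)
  fix G assume G: "G \<in> admissible_covers X f Z \<U> N \<theta>"
  define F where "F us = map (\<lambda>j. \<phi> j (us ! j)) [0..<length us]" for us
  have len [simp]: "length (F us) = length us" for us
    by (simp add: F_def)
  have nth: "F us ! j = \<phi> j (us ! j)" if "j < length us" for us j
    using that by (simp add: F_def)
  have mem: "us ! j \<in> \<U>" if "us \<in> strings \<U> m" "j < length us" for us m j
    using that by (auto simp: strings_def)
  have "F us \<in> strings \<V> m" if "us \<in> strings \<U> m" for us m
    using \<phi> mem[OF that] that by (auto simp: F_def strings_def)
  then have "F ` G \<subseteq> (\<Union>m\<in>admissible_lengths N \<theta>. strings \<V> m)"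
    using G unfolding admissible_covers_def by blast
  moreover have "\<pi> 1 ` Z \<subseteq> (\<Union>vs\<in>F ` G. string_set Y g vs)"
  proof clarify
    fix z assume "z \<in> Z"
    then obtain us where us: "us \<in> G" "z \<in> string_set X f us"
      using G unfolding admissible_covers_def by blast
    then have z: "z \<in> topspace X"
      by (simp add: string_set_def)
    obtain m where m: "us \<in> strings \<U> m"
      using G us(1) unfolding admissible_covers_def by blast
    have "seq_iter g 1 j (\<pi> 1 z) \<in> F us ! j" if j: "j < length us" for j
    proof -
      have "seq_iter f 1 j z \<in> us ! j"
        using us(2) j by (simp add: string_set_def)
      then have "\<pi> (Suc j) (seq_iter f 1 j z) \<in> \<phi> j (us ! j)"
        using \<phi>[OF mem[OF m j]] by blast
      then show ?thesis
        using semiconjugacy_seq_iter[OF f \<pi> z] nth[OF j] by simp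
    qed
    moreover have "\<pi> 1 z \<in> topspace Y"
      using \<pi> z unfolding semiconjugacy_def by blast
    ultimately have "\<pi> 1 z \<in> string_set Y g (F us)"
      by (simp add: string_set_def)
    then show "\<pi> 1 z \<in> (\<Union>vs\<in>F ` G. string_set Y g vs)"
      using us(1) by blast
  qed
  ultimately have "F ` G \<in> admissible_covers Y g (\<pi> 1 ` Z) \<V> N \<theta>"
    using G by (simp add: admissible_covers_def)
  moreover have "(\<Sum>\<^sub>\<infinity>vs\<in>F ` G. ennreal (exp (- \<alpha> * real (length vs))))
      \<le> (\<Sum>\<^sub>\<infinity>us\<in>G. ennreal (exp (- \<alpha> * real (length us))))"
    by (rule infsum_image_le_ennreal) simp
  ultimately show "\<exists>G'\<in>admissible_covers Y g (\<pi> 1 ` Z) \<V> N \<theta>.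
      (\<Sum>\<^sub>\<infinity>vs\<in>G'. ennreal (exp (- \<alpha> * real (length vs))))
        \<le> (\<Sum>\<^sub>\<infinity>us\<in>G. ennreal (exp (- \<alpha> * real (length us))))"
    by blast
qed

section \<open>From string sums to entropies of covers\<close>

lemma entropy_cover_mono:
  assumes "\<And>\<alpha> N. string_M Y g Z' \<alpha> \<V> N \<theta> \<le> string_M X f Z \<alpha> \<U> N \<theta>"
  shows "lower_entropy_cover Y g Z' \<V> \<theta> \<le> lower_entropy_cover X f Z \<U> \<theta>"
    and "upper_entropy_cover Y g Z' \<V> \<theta> \<le> upper_entropy_cover X f Z \<U> \<theta>"
proof -
  have "lower_m Y g Z' \<alpha> \<V> \<theta> \<le> lower_m X f Z \<alpha> \<U> \<theta>" for \<alpha>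
    unfolding lower_m_def using assms by (intro Liminf_mono always_eventually) auto
  \<comment> \<open>An exponent that annihilates the larger quantity annihilates the smaller one, so
    the infimum for \<open>Y\<close> runs over at least as many exponents.\<close>
  then have "lower_m Y g Z' \<alpha> \<V> \<theta> = 0" if "lower_m X f Z \<alpha> \<U> \<theta> = 0" for \<alpha>
    using that by (metis le_zero_eq)
  then show "lower_entropy_cover Y g Z' \<V> \<theta> \<le> lower_entropy_cover X f Z \<U> \<theta>"
    unfolding lower_entropy_cover_def by (intro INF_superset_mono) auto
  have "upper_m Y g Z' \<alpha> \<V> \<theta> \<le> upper_m X f Z \<alpha> \<U> \<theta>" for \<alpha>
    unfolding upper_m_def using assms by (intro Limsup_mono always_eventually) auto
  then have "upper_m Y g Z' \<alpha> \<V> \<theta> = 0" if "upper_m X f Z \<alpha> \<U> \<theta> = 0" for \<alpha>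
    using that by (metis le_zero_eq)
  then show "upper_entropy_cover Y g Z' \<V> \<theta> \<le> upper_entropy_cover X f Z \<U> \<theta>"
    unfolding upper_entropy_cover_def by (intro INF_superset_mono) auto
qed

text \<open>Pulling \<open>\<V>\<close> back along every \<pi> i could give infinitely many
  different covers of \<open>X\<close>. Equicontinuity replaces them by one finite cover
  \<open>\<U>\<close> serving all times; only the choice \<open>\<phi>\<close> still depends on the
  time.\<close>

lemma equicontinuous_cover_refinement:
  assumes X: "Metric_space X d" and cX: "compact_space (Metric_space.mtopology X d)"
    and Y: "Metric_space Y \<rho>" and cY: "compact_space (Metric_space.mtopology Y \<rho>)"
    and \<pi>: "\<And>i. i \<ge> 1 \<Longrightarrow> \<pi> i ` X \<subseteq> Y"
    and equi: "equicontinuous_seq X d \<rho> \<pi>"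
    and \<V>: "finite_open_cover (Metric_space.mtopology Y \<rho>) \<V>"
  obtains \<U> \<phi> where "finite_open_cover (Metric_space.mtopology X d) \<U>"
    and "\<And>j U. U \<in> \<U> \<Longrightarrow> \<phi> j U \<in> \<V> \<and> \<pi> (Suc j) ` U \<subseteq> \<phi> j U"
proof -
  interpret X: Metric_space X d by fact
  interpret Y: Metric_space Y \<rho> by fact
  have compact: "compactin Y.mtopology Y"
    using cY by (simp add: compact_space_def)
  have cover: "Y \<subseteq> \<Union>\<V>" and op: "\<And>V. V \<in> \<V> \<Longrightarrow> openin Y.mtopology V"
    using \<V> by (auto simp: finite_open_cover_def)
  have "\<exists>\<epsilon>>0. \<forall>y\<in>Y. \<exists>V\<in>\<V>. Y.mball y \<epsilon> \<subseteq> V"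
    by (rule Y.lebesgue_number[OF compact cover op])
  then obtain \<epsilon> where \<epsilon>: "\<epsilon> > 0" "\<And>y. y \<in> Y \<Longrightarrow> \<exists>V\<in>\<V>. Y.mball y \<epsilon> \<subseteq> V"
    by blast
  obtain \<delta> where \<delta>: "\<delta> > 0"
      "\<forall>i\<ge>1. \<forall>x\<in>X. \<forall>y\<in>X. d x y < \<delta> \<longrightarrow> \<rho> (\<pi> i x) (\<pi> i y) < \<epsilon>"
    using equi[unfolded equicontinuous_seq_def, rule_format, OF \<epsilon>(1)] by blast
  have "X.mtotally_bounded X"
    using cX by (intro X.compactin_imp_mtotally_bounded) (simp add: compact_space_def)
  then obtain K where K: "finite K" "K \<subseteq> X" "X \<subseteq> (\<Union>x\<in>K. X.mball x \<delta>)"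
    using \<delta>(1) unfolding X.mtotally_bounded_def by meson
  define \<U> where "\<U> = (\<lambda>x. X.mball x \<delta>) ` K"
  \<comment> \<open>\<open>finite_open_cover\<close> asks for equality; the other inclusion holds
    because \<open>X.mball\<close> contains only points of \<open>X\<close>.\<close>
  have "\<Union>\<U> = X"
    using K(3) by (auto simp: \<U>_def)
  then have "finite_open_cover X.mtopology \<U>"
    using K(1) by (auto simp: finite_open_cover_def \<U>_def)
  moreover have "\<exists>V\<in>\<V>. \<pi> (Suc j) ` U \<subseteq> V" if "U \<in> \<U>" for j U
  proof -
    obtain x where x: "x \<in> K" "U = X.mball x \<delta>"
      using \<open>U \<in> \<U>\<close> by (auto simp: \<U>_def)
    have "\<rho> (\<pi> (Suc j) x) (\<pi> (Suc j) y) < \<epsilon>" if "y \<in> X" "d x y < \<delta>" for y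
      using \<delta>(2)[rule_format, of "Suc j" x y] x(1) K(2) that by auto
    \<comment> \<open>The image of a \<delta>-ball lies in the \<epsilon>-ball about the image of
      its centre, and the Lebesgue number puts the latter inside a single member of
      \<open>\<V>\<close>.\<close>
    then have "\<pi> (Suc j) ` U \<subseteq> Y.mball (\<pi> (Suc j) x) \<epsilon>"
      using x K(2) \<pi>[of "Suc j"] by (auto simp: image_subset_iff)
    moreover have "\<pi> (Suc j) x \<in> Y"
      using x K(2) \<pi>[of "Suc j"] by auto
    ultimately show ?thesis
      using \<epsilon>(2)[of "\<pi> (Suc j) x"] by (meson subset_trans)
  qed
  \<comment> \<open>The condition on \<open>U\<close> is moved under the existential quantifier, so
    that choice yields a total function of \<open>j\<close> and \<open>U\<close>.\<close>
  then have "\<forall>j U. \<exists>V. U \<in> \<U> \<longrightarrow> V \<in> \<V> \<and> \<pi> (Suc j) ` U \<subseteq> V"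
    by meson
  then obtain \<phi> where "\<forall>j U. U \<in> \<U> \<longrightarrow> \<phi> j U \<in> \<V> \<and> \<pi> (Suc j) ` U \<subseteq> \<phi> j U"
    unfolding choice_iff by (elim exE)
  ultimately show thesis
    by (intro that[of \<U> \<phi>]) simp_all
qed

lemma equisemiconjugacy_entropy_le:
  assumes X: "Metric_space X d" and cX: "compact_space (Metric_space.mtopology X d)"
    and Y: "Metric_space Y \<rho>" and cY: "compact_space (Metric_space.mtopology Y \<rho>)"
    and f: "\<And>i. i \<ge> 1 \<Longrightarrow>
      continuous_map (Metric_space.mtopology X d) (Metric_space.mtopology X d) (f i)"
    and \<pi>: "equisemiconjugacy X d f Y \<rho> g \<pi>" and Z: "Z \<subseteq> X"
  shows "lower_entropy (Metric_space.mtopology Y \<rho>) g (\<pi> 1 ` Z) \<theta>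
      \<le> lower_entropy (Metric_space.mtopology X d) f Z \<theta>"
    and "upper_entropy (Metric_space.mtopology Y \<rho>) g (\<pi> 1 ` Z) \<theta>
      \<le> upper_entropy (Metric_space.mtopology X d) f Z \<theta>"
proof -
  interpret X: Metric_space X d by fact
  interpret Y: Metric_space Y \<rho> by fact
  have semi: "semiconjugacy X.mtopology f Y.mtopology g \<pi>" and equi: "equicontinuous_seq X d \<rho> \<pi>"
    using \<pi> by (auto simp: equisemiconjugacy_def)
  have img: "\<pi> i ` X \<subseteq> Y" if "i \<ge> 1" for i
    using semi that by (simp add: semiconjugacy_def)
  \<comment> \<open>The cover \<open>\<U>\<close> is fixed before \<open>\<alpha>\<close> and
    \<open>N\<close>: an entropy relative to a cover takes a limit in \<open>N\<close> and an
    infimum over \<open>\<alpha>\<close> with the cover held constant.\<close>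
  have *: "\<exists>\<U>. finite_open_cover X.mtopology \<U> \<and>
      (\<forall>\<alpha> N. string_M Y.mtopology g (\<pi> 1 ` Z) \<alpha> \<V> N \<theta> \<le> string_M X.mtopology f Z \<alpha> \<U> N \<theta>)"
    if \<V>: "finite_open_cover Y.mtopology \<V>" for \<V>
  proof -
    obtain \<U> \<phi> where U: "finite_open_cover X.mtopology \<U>"
      and "\<And>j U. U \<in> \<U> \<Longrightarrow> \<phi> j U \<in> \<V> \<and> \<pi> (Suc j) ` U \<subseteq> \<phi> j U"
      using equicontinuous_cover_refinement[OF X cX Y cY img equi \<V>] by blast
    then have "string_M Y.mtopology g (\<pi> 1 ` Z) \<alpha> \<V> N \<theta> \<le> string_M X.mtopology f Z \<alpha> \<U> N \<theta>" for \<alpha> N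
      using string_M_le_semiconjugacy[OF f semi, of Z \<U> \<phi> \<V>] Z by simp
    then show ?thesis
      using U by blast
  qed
  show "lower_entropy Y.mtopology g (\<pi> 1 ` Z) \<theta> \<le> lower_entropy X.mtopology f Z \<theta>"
    unfolding lower_entropy_def
  proof (rule SUP_mono)
    fix \<V> assume "\<V> \<in> {\<V>. finite_open_cover Y.mtopology \<V>}"
    then obtain \<U> where "finite_open_cover X.mtopology \<U>"
      and "\<And>\<alpha> N. string_M Y.mtopology g (\<pi> 1 ` Z) \<alpha> \<V> N \<theta> \<le> string_M X.mtopology f Z \<alpha> \<U> N \<theta>"
      using * by blast
    then show "\<exists>\<U>\<in>{\<U>. finite_open_cover X.mtopology \<U>}.
        lower_entropy_cover Y.mtopology g (\<pi> 1 ` Z) \<V> \<theta> \<le> lower_entropy_cover X.mtopology f Z \<U> \<theta>"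
      using entropy_cover_mono(1)[of Y.mtopology g "\<pi> 1 ` Z" \<V> \<theta> X.mtopology f Z \<U>] by blast
  qed
  show "upper_entropy Y.mtopology g (\<pi> 1 ` Z) \<theta> \<le> upper_entropy X.mtopology f Z \<theta>"
    unfolding upper_entropy_def
  proof (rule SUP_mono)
    fix \<V> assume "\<V> \<in> {\<V>. finite_open_cover Y.mtopology \<V>}"
    then obtain \<U> where "finite_open_cover X.mtopology \<U>"
      and "\<And>\<alpha> N. string_M Y.mtopology g (\<pi> 1 ` Z) \<alpha> \<V> N \<theta> \<le> string_M X.mtopology f Z \<alpha> \<U> N \<theta>"
      using * by blast
    then show "\<exists>\<U>\<in>{\<U>. finite_open_cover X.mtopology \<U>}.
        upper_entropy_cover Y.mtopology g (\<pi> 1 ` Z) \<V> \<theta> \<le> upper_entropy_cover X.mtopology f Z \<U> \<theta>"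
      using entropy_cover_mono(2)[of Y.mtopology g "\<pi> 1 ` Z" \<V> \<theta> X.mtopology f Z \<U>] by blast
  qed
qed

section \<open>Shifted and inverse sequences\<close>

lemma equisemiconjugacy_shift_seq:
  assumes "equisemiconjugacy X d f Y \<rho> g \<pi>" "k \<ge> 1"
  shows "equisemiconjugacy X d (shift_seq k f) Y \<rho> (shift_seq k g) (shift_seq k \<pi>)"
proof -
  \<comment> \<open>Since \<open>k\<close> and \<open>i\<close> are at least 1, the truncated
    subtraction is exact: shifted indices stay in the range where the hypotheses apply, and
    successors go to successors.\<close>
  have 1: "shift_seq k h i = h (k + i - 1)" "shift_seq k h (Suc i) = h (Suc (k + i - 1))"
    "k + i - 1 \<ge> 1" if "i \<ge> 1" for i and h :: "nat \<Rightarrow> 'c"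
    using that assms(2) by (auto simp: shift_seq_def)
  have "semiconjugacy (Metric_space.mtopology X d) (shift_seq k f)
      (Metric_space.mtopology Y \<rho>) (shift_seq k g) (shift_seq k \<pi>)"
    unfolding semiconjugacy_def
  proof (intro allI impI)
    fix i :: nat assume i: "1 \<le> i"
    show "continuous_map (Metric_space.mtopology X d) (Metric_space.mtopology Y \<rho>) (shift_seq k \<pi> i) \<and>
        shift_seq k \<pi> i ` topspace (Metric_space.mtopology X d) = topspace (Metric_space.mtopology Y \<rho>) \<and>
        (\<forall>x\<in>topspace (Metric_space.mtopology X d).
           shift_seq k \<pi> (Suc i) (shift_seq k f i x) = shift_seq k g i (shift_seq k \<pi> i x))"
      unfolding 1(1,2)[OF i]
      using assms(1) 1(3)[OF i] unfolding equisemiconjugacy_def semiconjugacy_def by blast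
  qed
  moreover have "equicontinuous_seq X d \<rho> (shift_seq k \<pi>)"
    unfolding equicontinuous_seq_def
  proof (intro allI impI)
    fix \<epsilon> :: real assume "\<epsilon> > 0"
    then obtain \<delta> where "\<delta> > 0"
      and "\<forall>i\<ge>1. \<forall>x\<in>X. \<forall>y\<in>X. d x y < \<delta> \<longrightarrow> \<rho> (\<pi> i x) (\<pi> i y) < \<epsilon>"
      using assms(1) unfolding equisemiconjugacy_def equicontinuous_seq_def by blast
    then show "\<exists>\<delta>>0. \<forall>i\<ge>1. \<forall>x\<in>X. \<forall>y\<in>X. d x y < \<delta> \<longrightarrow>
        \<rho> (shift_seq k \<pi> i x) (shift_seq k \<pi> i y) < \<epsilon>"
      using 1(1,3) by metis
  qed
  ultimately show ?thesis
    by (simp add: equisemiconjugacy_def)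
qed

text \<open>Equicontinuity of the inverses is part of an equiconjugacy. What remains is their
  continuity, their surjectivity and the commuting squares with the vertical arrows
  reversed.\<close>

lemma equiconjugacy_inverse:
  assumes X: "Metric_space X d" and Y: "Metric_space Y \<rho>"
    and f: "\<And>i. i \<ge> 1 \<Longrightarrow>
      continuous_map (Metric_space.mtopology X d) (Metric_space.mtopology X d) (f i)"
    and \<pi>: "equiconjugacy X d f Y \<rho> g \<pi>"
  shows "equisemiconjugacy Y \<rho> g X d f (\<lambda>i. inv_into X (\<pi> i))"
proof -
  interpret X: Metric_space X d by fact
  interpret Y: Metric_space Y \<rho> by fact
  have hom: "homeomorphic_map X.mtopology Y.mtopology (\<pi> i)" if "i \<ge> 1" for i
    using \<pi> that by (simp add: equiconjugacy_def)
  then have inj: "inj_on (\<pi> i) X" and img: "\<pi> i ` X = Y" if "i \<ge> 1" for i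
    using that homeomorphic_imp_injective_map homeomorphic_imp_surjective_map by fastforce+
  have comm: "\<pi> (Suc i) (f i x) = g i (\<pi> i x)" if "i \<ge> 1" "x \<in> X" for i x
    using \<pi> that by (simp add: equiconjugacy_def equisemiconjugacy_def semiconjugacy_def)
  have "continuous_map Y.mtopology X.mtopology (inv_into X (\<pi> i))" if i: "i \<ge> 1" for i
  proof -
    obtain h where h: "homeomorphic_maps X.mtopology Y.mtopology (\<pi> i) h"
      using hom[OF i] homeomorphic_map_maps by blast
    \<comment> \<open>The homeomorphism supplies some continuous inverse \<open>h\<close>. By
      injectivity it agrees on \<open>Y\<close> with \<open>inv_into X (\<pi> i)\<close>, to which
      continuity then passes.\<close>
    have "h y = inv_into X (\<pi> i) y" if "y \<in> Y" for y
    proof -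
      have "h y \<in> X" "\<pi> i (h y) = y"
        using h that continuous_map_image_subset_topspace[of Y.mtopology X.mtopology h]
        by (auto simp: homeomorphic_maps_def)
      then show ?thesis
        using inj[OF i] by (metis inv_into_f_f)
    qed
    then show ?thesis
      using h continuous_map_eq[of Y.mtopology X.mtopology h] by (simp add: homeomorphic_maps_def)
  qed
  moreover have "inv_into X (\<pi> i) ` Y = X" if "i \<ge> 1" for i
    using inj[OF that] img[OF that] by (metis inv_into_image_cancel subset_refl)
  moreover have "inv_into X (\<pi> (Suc i)) (g i y) = f i (inv_into X (\<pi> i) y)"
    if i: "i \<ge> 1" and y: "y \<in> Y" for i y
  proof -
    obtain x where x: "x \<in> X" "y = \<pi> i x"
      using img[OF i] y by blast
    \<comment> \<open>\<open>inv_into X\<close> cancels \<pi> (Suc i) only at points of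
      \<open>X\<close>, so the step must not leave \<open>X\<close>.\<close>
    have "f i x \<in> X"
      using continuous_map_image_subset_topspace[OF f[OF i]] x(1) by auto
    then show ?thesis
      using x inj[OF i] inj[of "Suc i"] by (simp flip: comm[OF i x(1)])
  qed
  ultimately show ?thesis
    using \<pi> by (simp add: equiconjugacy_def equisemiconjugacy_def semiconjugacy_def)
qed

theorem theorem4p2:
  fixes X :: "'a set" and d :: "'a \<Rightarrow> 'a \<Rightarrow> real" and f :: "nat \<Rightarrow> 'a \<Rightarrow> 'a"
    and Y :: "'b set" and \<rho> :: "'b \<Rightarrow> 'b \<Rightarrow> real" and g :: "nat \<Rightarrow> 'b \<Rightarrow> 'b"
    and \<pi> :: "nat \<Rightarrow> 'a \<Rightarrow> 'b" and Z :: "'a set" and k :: nat and \<theta> :: real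
  defines "TX \<equiv> Metric_space.mtopology X d"
    and "TY \<equiv> Metric_space.mtopology Y \<rho>"
  assumes "Metric_space X d" and "compact_space TX"
    and "Metric_space Y \<rho>" and "compact_space TY"
    and "\<And>i. i \<ge> 1 \<Longrightarrow> continuous_map TX TX (f i)"
    and "\<And>i. i \<ge> 1 \<Longrightarrow> continuous_map TY TY (g i)"
    and "equisemiconjugacy X d f Y \<rho> g \<pi>"
    and "Z \<subseteq> X" and "k \<ge> 1" and "0 \<le> \<theta>" and "\<theta> \<le> 1"
  shows "lower_entropy TX (shift_seq k f) Z \<theta> \<ge> lower_entropy TY (shift_seq k g) (\<pi> k ` Z) \<theta> \<and>
         upper_entropy TX (shift_seq k f) Z \<theta> \<ge> upper_entropy TY (shift_seq k g) (\<pi> k ` Z) \<theta> \<and>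
         (equiconjugacy X d f Y \<rho> g \<pi> \<longrightarrow>
            lower_entropy TX (shift_seq k f) Z \<theta> = lower_entropy TY (shift_seq k g) (\<pi> k ` Z) \<theta> \<and>
            upper_entropy TX (shift_seq k f) Z \<theta> = upper_entropy TY (shift_seq k g) (\<pi> k ` Z) \<theta>)"
proof -
  note X = assms(3,4)[unfolded TX_def] and Y = assms(5,6)[unfolded TY_def]
  have f: "continuous_map (Metric_space.mtopology X d) (Metric_space.mtopology X d) (shift_seq k f i)"
    and g: "continuous_map (Metric_space.mtopology Y \<rho>) (Metric_space.mtopology Y \<rho>) (shift_seq k g i)"
    if "i \<ge> 1" for i
    using assms(7,8)[of "k + i - 1"] that \<open>k \<ge> 1\<close> by (auto simp: shift_seq_def TX_def TY_def)
  have at_1: "shift_seq k h 1 = h k" for h :: "nat \<Rightarrow> 'c"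
    by (simp add: shift_seq_def)
  have le: "lower_entropy TY (shift_seq k g) (\<pi> k ` Z) \<theta> \<le> lower_entropy TX (shift_seq k f) Z \<theta>"
    "upper_entropy TY (shift_seq k g) (\<pi> k ` Z) \<theta> \<le> upper_entropy TX (shift_seq k f) Z \<theta>"
    using equisemiconjugacy_entropy_le[OF X Y f equisemiconjugacy_shift_seq[OF assms(9,11)] assms(10)]
    unfolding at_1 TX_def TY_def by blast+
  have ge: "lower_entropy TX (shift_seq k f) Z \<theta> \<le> lower_entropy TY (shift_seq k g) (\<pi> k ` Z) \<theta>"
    "upper_entropy TX (shift_seq k f) Z \<theta> \<le> upper_entropy TY (shift_seq k g) (\<pi> k ` Z) \<theta>"
    if conj: "equiconjugacy X d f Y \<rho> g \<pi>"
  proof -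
    have inv: "equisemiconjugacy Y \<rho> g X d f (\<lambda>i. inv_into X (\<pi> i))"
      using equiconjugacy_inverse[OF assms(3,5) assms(7)[unfolded TX_def] conj] .
    have "homeomorphic_map TX TY (\<pi> k)"
      using conj assms(11) by (simp add: equiconjugacy_def TX_def TY_def)
    then have "inj_on (\<pi> k) X" "\<pi> k ` X = Y"
      using homeomorphic_imp_injective_map homeomorphic_imp_surjective_map
      by (fastforce simp: TX_def TY_def Metric_space.topspace_mtopology assms(3,5))+
    \<comment> \<open>The inverse at time \<open>k\<close> carries the image of \<open>Z\<close>
      back to exactly \<open>Z\<close>, so the inequality for the inverse sequence is the converse
      for the original set.\<close>
    then have Z: "inv_into X (\<pi> k) ` \<pi> k ` Z = Z" and sub: "\<pi> k ` Z \<subseteq> Y"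
      using assms(10) by (auto simp: inv_into_image_cancel)
    show "lower_entropy TX (shift_seq k f) Z \<theta> \<le> lower_entropy TY (shift_seq k g) (\<pi> k ` Z) \<theta>"
      "upper_entropy TX (shift_seq k f) Z \<theta> \<le> upper_entropy TY (shift_seq k g) (\<pi> k ` Z) \<theta>"
      using equisemiconjugacy_entropy_le[OF Y X g equisemiconjugacy_shift_seq[OF inv assms(11)] sub]
      unfolding at_1 TX_def TY_def Z by blast+
  qed
  show ?thesis
    using le ge by (auto intro: antisym)
qed

end
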